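(* Let $m$ and $N$ be positive integers, and let $U_1(z)=\big[u_{11}(z),u_{12}(z),\ldots,u_{1m}(z)\big]$ be a polynomial (row) vector-function, $u_{1j}(z)=\sum_{n=0}^{N}\alpha_{jn}z^n$ with $\alpha_{jn}\in\mathbb{C}$, $j=1,2,\ldots,m$, of length $N$ (that is, $\sum_{j=1}^m|\alpha_{jN}|>0$), which is of unit norm on $\mathbb{T}$: $$\|U_1(z)\|_{\mathbb{C}^m}^2=\sum_{j=1}^m|u_{1j}(z)|^2=1,\qquad z\in\mathbb{T}.$$ Then there exists a paraunitary polynomial matrix-function $U(z)$ of size $m$ and length $N$, with determinant of the form $\det U(z)=cz^N$ for some constant $c$ with $|c|=1$, whose first row is equal to $U_1(z)$. Moreover, $U(z)$ is unique up to a constant left multiplier of the block form $\left(\begin{matrix}1&0\\0&V\end{matrix}\right)$, where $V$ is an $(m-1)\times(m-1)$ unitary matrix: any two such matrix-functions $U(z)$ and $\widetilde U(z)$ satisfy $\widetilde U(z)=\left(\begin{matrix}1&0\\0&V\end{matrix}\right)U(z)$ for some constant $(m-1)\times(m-1)$ unitary matrix $V$.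
   Context: $\mathbb{T}=\{z\in\mathbb{C}:|z|=1\}$. A polynomial matrix-function $U(z)=\sum_{n=0}^{N}\rho_nz^n$, $\rho_n\in\mathbb{C}^{m\times m}$, is called paraunitary if $U(z)U^*(z)=I_m$ for all $z\in\mathbb{C}\setminus\{0\}$, where $U^*(z)=\overline{U(1/\overline z)}^{\,T}=\sum_{n=0}^{N}\rho_n^*z^{-n}$, $\rho_n^*=\overline{\rho_n}^{\,T}$, and $I_m$ is the $m\times m$ identity matrix. The integer $m$ is called the size of $U$, and $N$ is called the length of $U$ (with $\rho_N\neq\mathbf{0}$). *)

theory Defs
  imports "Jordan_Normal_Form.Schur_Decomposition"
begin

text \<open>
  A polynomial matrix-function is represented by a matrix over \<^typ>\<open>complex poly\<close>.  Matrices with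
  explicit dimensions are used because sizes \<open>m\<close> and \<open>m - 1\<close> occur together; size \<open>0\<close> is allowed.
\<close>

definition eval_pmat :: "complex poly mat \<Rightarrow> complex \<Rightarrow> complex mat" where
  "eval_pmat U z = map_mat (\<lambda>p. poly p z) U"

definition coeff_pmat :: "complex poly mat \<Rightarrow> nat \<Rightarrow> complex mat" where
  "coeff_pmat U n = map_mat (\<lambda>p. coeff p n) U"

definition pmat_length :: "complex poly mat \<Rightarrow> nat \<Rightarrow> bool" where
  "pmat_length U N \<longleftrightarrow>
     coeff_pmat U N \<noteq> 0\<^sub>m (dim_row U) (dim_col U) \<and>
     (\<forall>n>N. coeff_pmat U n = 0\<^sub>m (dim_row U) (dim_col U))"

text \<open>The value \<open>U\<^sup>*(z)\<close> is the conjugate transpose of \<open>U(1 / cnj z)\<close>, a Laurent polynomial in \<open>z\<close>.\<close>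

definition para_adjoint :: "complex poly mat \<Rightarrow> complex \<Rightarrow> complex mat" where
  "para_adjoint U z = mat_adjoint (eval_pmat U (1 / cnj z))"

definition paraunitary :: "nat \<Rightarrow> complex poly mat \<Rightarrow> bool" where
  "paraunitary m U \<longleftrightarrow>
     U \<in> carrier_mat m m \<and>
     (\<forall>z. z \<noteq> 0 \<longrightarrow> eval_pmat U z * para_adjoint U z = 1\<^sub>m m)"

definition unitary_mat :: "nat \<Rightarrow> complex mat \<Rightarrow> bool" where
  "unitary_mat k V \<longleftrightarrow>
     V \<in> carrier_mat k k \<and> V * mat_adjoint V = 1\<^sub>m k \<and> mat_adjoint V * V = 1\<^sub>m k"

definition paraunitary_completion ::
  "nat \<Rightarrow> nat \<Rightarrow> complex poly vec \<Rightarrow> complex poly mat \<Rightarrow> bool" where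
  "paraunitary_completion m N U\<^sub>1 U \<longleftrightarrow>
     paraunitary m U \<and> pmat_length U N \<and>
     (\<exists>c. cmod c = 1 \<and> (\<forall>z. det (eval_pmat U z) = c * z ^ N)) \<and>
     row U 0 = U\<^sub>1"

end

theory Submission
  imports Defs
begin

text \<open>
  Both halves of the theorem come from peeling off one degree at a time.  Let \<open>u\<close> be the given row,
  let \<open>a \<noteq> 0\<close> be its coefficient vector at \<open>z\<^sup>N\<close>, with \<open>N > 0\<close>, and let \<open>Q\<close> be a constant
  unitary matrix whose first row is \<open>a\<close> normalised.  Put \<open>B(z) = diag(z, 1, \<dots>, 1) Q\<close>, a paraunitary
  matrix of determinant \<open>z det Q\<close>.

  Suppose that a polynomial matrix \<open>A\<close> of degree at most \<open>N\<close> satisfies \<open>A A\<^sup>* = 1\<close> and has first row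
  \<open>u\<close>.  Comparing the coefficients of \<open>z\<^sup>-\<^sup>N\<close> in \<open>A A\<^sup>* = 1\<close> shows that every row of \<open>A(0)\<close> is
  orthogonal to \<open>a\<close> (\<open>extreme_coeffs_orthogonal\<close>).  Hence the first column of \<open>A Q\<^sup>*\<close> is divisible by
  \<open>z\<close>, and \<open>A = Y B\<close> for a polynomial matrix \<open>Y\<close> (\<open>split_off_mult\<close>).  Applied to the single row
  \<open>u\<close>, this gives \<open>u = v B\<close>, where \<open>v\<close> is again of unit norm and has length exactly \<open>N - 1\<close>: only the
  first entry of \<open>u Q\<^sup>*\<close> reaches degree \<open>N\<close>, and that entry loses a factor \<open>z\<close>.  Applied to a
  completion of \<open>u\<close>, it gives a completion of \<open>v\<close>, so that \<open>Y \<mapsto> Y B\<close> is a bijection from the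
  completions of \<open>v\<close> onto those of \<open>u\<close> (\<open>unit_row_step\<close>).  Right multiplication by \<open>B\<close> commutes
  with left multiplication by a constant matrix, so existence and uniqueness for \<open>u\<close> both follow from
  those for \<open>v\<close>.

  The argument needs to know that a completion has degree at most \<open>N\<close>, also for the factors \<open>Y\<close> met on
  the way.  This is forced by the determinant (\<open>degree_le_of_det_monom\<close>): from \<open>det U = c z\<^sup>N\<close> one gets
  \<open>U\<^sup>* = U\<^sup>-\<^sup>1 = c\<^sup>-\<^sup>1 z\<^sup>-\<^sup>N adj U\<close>, which has no power of \<open>z\<close> below \<open>z\<^sup>-\<^sup>N\<close>.  For \<open>N = 0\<close> every
  completion is therefore a constant unitary matrix.  Such a matrix exists by Gram-Schmidt, and if
  \<open>G\<close> and \<open>H\<close> are two of them with the same first row, then \<open>H G\<^sup>*\<close> is unitary with first row and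
  first column equal to the first unit vector.
\<close>

section \<open>Adjoints and unitary matrices\<close>

lemma mat_adjoint_eq:
  "mat_adjoint (A :: complex mat) = mat (dim_col A) (dim_row A) (\<lambda>(i, j). cnj (A $$ (j, i)))"
  unfolding mat_adjoint_def by (intro eq_matI) (auto simp: mat_of_rows_def)

lemma mat_adjoint_carrier [simp, intro]:
  "A \<in> carrier_mat n m \<Longrightarrow> mat_adjoint (A :: complex mat) \<in> carrier_mat m n"
  by (auto simp: mat_adjoint_eq)

lemma mat_adjoint_mult:
  assumes "A \<in> carrier_mat n m" "B \<in> carrier_mat m k"
  shows "mat_adjoint (A * B :: complex mat) = mat_adjoint B * mat_adjoint A"
  using assms by (intro eq_matI) (auto simp: mat_adjoint_eq scalar_prod_def mult.commute intro!: sum.cong)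

lemma mat_adjoint_adjoint [simp]: "mat_adjoint (mat_adjoint A) = (A :: complex mat)"
  by (intro eq_matI) (auto simp: mat_adjoint_eq)

lemma index_mult_mat_sum:
  assumes "A \<in> carrier_mat r n" "B \<in> carrier_mat n c" "i < r" "j < c"
  shows "(A * B) $$ (i, j) = (\<Sum>k<n. A $$ (i, k) * B $$ (k, j))"
  using assms by (auto simp: scalar_prod_def lessThan_atLeast0)

lemma index_mult_adjoint:
  assumes "A \<in> carrier_mat r n" "B \<in> carrier_mat c n" "i < r" "j < c"
  shows "(A * mat_adjoint B :: complex mat) $$ (i, j) = (\<Sum>k<n. A $$ (i, k) * cnj (B $$ (j, k)))"
  using assms by (auto simp: mat_adjoint_eq scalar_prod_def lessThan_atLeast0)

lemma unitary_matI:
  assumes "V \<in> carrier_mat k k" "V * mat_adjoint V = 1\<^sub>m k"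
  shows "unitary_mat k V"
  using assms mat_mult_left_right_inverse[OF assms(1) mat_adjoint_carrier[OF assms(1)] assms(2)]
  by (simp add: unitary_mat_def)

lemma gram_mat_mult:
  assumes "A \<in> carrier_mat r m" "B \<in> carrier_mat m k"
  shows "(A * B) * mat_adjoint (A * B) = A * (B * mat_adjoint B) * mat_adjoint (A :: complex mat)"
proof -
  note c = assms mat_adjoint_carrier[OF assms(1)] mat_adjoint_carrier[OF assms(2)]
  show ?thesis
    unfolding mat_adjoint_mult[OF assms]
    using assoc_mult_mat[OF c(1,2) mult_carrier_mat[OF c(4,3)]] assoc_mult_mat[OF c(2,4,3)]
      assoc_mult_mat[OF c(1) mult_carrier_mat[OF c(2,4)] c(3)] by simp
qed

lemma row_mult:
  assumes "A \<in> carrier_mat r m" "B \<in> carrier_mat m k" "i < r"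
  shows "row (A * B) i = vec k (\<lambda>j. row A i \<bullet> col B j)"
  using assms by (intro eq_vecI) auto

text \<open>
  Gram-Schmidt, started from a basis containing \<open>a\<close>, yields an orthogonal basis whose first
  vector is \<open>a\<close> itself; dividing each vector by its norm gives the rows of \<open>Q\<close>.
\<close>

lemma unitary_with_first_row:
  fixes a :: "complex vec"
  assumes a: "a \<in> carrier_vec m" and nz: "a \<noteq> 0\<^sub>v m"
  obtains Q where "unitary_mat m Q"
    "\<And>j. j < m \<Longrightarrow> a $ j = of_real (sqrt (\<Sum>k<m. (cmod (a $ k))\<^sup>2)) * Q $$ (0, j)"
proof -
  interpret cof_vec_space m "TYPE(complex)" .
  define ws where "ws = gram_schmidt m (basis_completion a)"
  note bc = basis_completion[OF a nz]
  note gs = gram_schmidt_result[OF bc(2,4,5) ws_def]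
  have len: "length ws = m" using gs(4) bc(6) by simp
  have m: "m > 0" using a nz by (cases m) auto
  obtain b where b: "basis_completion a = a # b" using bc(7) by (cases "basis_completion a") (use bc(6) m in auto)
  have "hd ws = a" unfolding ws_def b using gram_schmidt_hd[OF a] .
  hence ws0: "ws ! 0 = a" using len m by (cases ws) auto
  define s where "s w = sqrt (\<Sum>k<m. (cmod (w $ k))\<^sup>2)" for w :: "complex vec"
  have s_sq: "w \<bullet>c w = of_real ((s w)\<^sup>2)" if "w \<in> carrier_vec m" for w
    using that by (auto simp: scalar_prod_def s_def lessThan_atLeast0 sum_nonneg complex_norm_square
       simp del: of_real_power intro!: sum.cong)
  have wsc: "ws ! i \<in> carrier_vec m" if "i < m" for i
    using that len gs(3) by (meson nth_mem subset_iff)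
  have s_nz: "s (ws ! i) \<noteq> 0" if "i < m" for i
    using corthogonalD[OF gs(2), of i i] that len s_sq[OF wsc[OF that]] by auto
  have orth: "(\<Sum>k<m. (ws ! i) $ k * cnj ((ws ! j) $ k)) = (if i = j then of_real ((s (ws ! i))\<^sup>2) else 0)"
    if "i < m" "j < m" for i j
  proof -
    have "(\<Sum>k<m. (ws ! i) $ k * cnj ((ws ! j) $ k)) = (ws ! i) \<bullet>c (ws ! j)"
      using wsc[OF that(2)] by (auto simp: scalar_prod_def lessThan_atLeast0)
    thus ?thesis using corthogonalD[OF gs(2), of i j] that len s_sq[OF wsc[OF that(1)]] by auto
  qed
  define Q where "Q = mat m m (\<lambda>(i, j). (ws ! i) $ j / of_real (s (ws ! i)))"
  have "unitary_mat m Q"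
  proof (rule unitary_matI)
    show Q: "Q \<in> carrier_mat m m" by (simp add: Q_def)
    show "Q * mat_adjoint Q = 1\<^sub>m m"
    proof (rule eq_matI)
      fix i j assume "i < dim_row (1\<^sub>m m :: complex mat)" "j < dim_col (1\<^sub>m m :: complex mat)"
      hence ij: "i < m" "j < m" by auto
      have "(Q * mat_adjoint Q) $$ (i, j)
          = (\<Sum>k<m. (ws ! i) $ k * cnj ((ws ! j) $ k)) / (of_real (s (ws ! i)) * of_real (s (ws ! j)))"
        unfolding index_mult_adjoint[OF Q Q ij] sum_divide_distrib using ij by (simp add: Q_def)
      also have "\<dots> = 1\<^sub>m m $$ (i, j)"
        unfolding orth[OF ij] using ij s_nz by (simp add: power2_eq_square)
      finally show "(Q * mat_adjoint Q) $$ (i, j) = 1\<^sub>m m $$ (i, j)" .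
    qed (use Q in \<open>auto simp: mat_adjoint_eq\<close>)
  qed
  moreover have "a $ j = of_real (s a) * Q $$ (0, j)" if "j < m" for j
    using that m s_nz[OF m] by (simp add: Q_def ws0)
  ultimately show thesis using that unfolding s_def by blast
qed

section \<open>Evaluation of polynomial matrices\<close>

lemma eval_pmat_carrier [simp, intro]: "A \<in> carrier_mat n m \<Longrightarrow> eval_pmat A z \<in> carrier_mat n m"
  by (auto simp: eval_pmat_def)

lemma dim_eval_pmat [simp]:
  "dim_row (eval_pmat A z) = dim_row A" "dim_col (eval_pmat A z) = dim_col A"
  by (simp_all add: eval_pmat_def)

lemma eval_pmat_mult:
  assumes "A \<in> carrier_mat n m" "B \<in> carrier_mat m k"
  shows "eval_pmat (A * B) z = eval_pmat A z * eval_pmat B z"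
  unfolding eval_pmat_def by (rule semiring_hom.mat_hom_mult[OF poly_hom.semiring_hom_axioms assms])

lemma det_eval_pmat: "det (eval_pmat A z) = poly (det A) z"
  unfolding eval_pmat_def by (rule comm_ring_hom.hom_det[OF poly_hom.comm_ring_hom_axioms])

section \<open>Conjugate reversal and identities on the unit circle\<close>

text \<open>
  The polynomial \<open>z\<^sup>K p\<^sup>*(z)\<close>, provided that \<open>K\<close> is at least the degree of \<open>p\<close>.  A common \<open>K\<close> for
  all entries of a matrix turns an identity between Laurent polynomials into one between polynomials.
\<close>

definition conj_reverse :: "nat \<Rightarrow> complex poly \<Rightarrow> complex poly" where
  "conj_reverse K p = (\<Sum>l\<le>K. monom (cnj (coeff p (K - l))) l)"

lemma coeff_conj_reverse: "coeff (conj_reverse K p) l = (if l \<le> K then cnj (coeff p (K - l)) else 0)"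
  by (simp add: conj_reverse_def coeff_sum if_distrib[of cnj] sum.delta coeff_monom cong: if_cong)

lemma poly_conj_reverse:
  assumes "degree p \<le> K" "z \<noteq> 0"
  shows "poly (conj_reverse K p) z = z ^ K * cnj (poly p (1 / cnj z))"
proof -
  have "poly (conj_reverse K p) z = (\<Sum>l\<le>K. cnj (coeff p (K - l)) * z ^ l)"
    by (simp add: conj_reverse_def poly_sum poly_monom)
  also have "\<dots> = (\<Sum>l\<le>K. cnj (coeff p l) * z ^ (K - l))"
    by (rule sum.reindex_bij_witness[of _ "\<lambda>l. K - l" "\<lambda>l. K - l"]) auto
  also have "\<dots> = z ^ K * cnj (\<Sum>l\<le>K. coeff p l * (1 / cnj z) ^ l)"
    using \<open>z \<noteq> 0\<close> by (simp add: sum_distrib_left power_diff field_simps)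
  also have "(\<Sum>l\<le>K. coeff p l * (1 / cnj z) ^ l) = poly p (1 / cnj z)"
    unfolding poly_altdef
    by (rule sum.mono_neutral_right) (use assms(1) in \<open>auto simp: coeff_eq_0\<close>)
  finally show ?thesis .
qed

text \<open>
  The circle contains the roots of unity of every order.
\<close>

lemma infinite_unit_circle: "infinite {z :: complex. cmod z = 1}"
proof
  assume fin: "finite {z :: complex. cmod z = 1}"
  define n where "n = Suc (card {z :: complex. cmod z = 1})"
  have "{z :: complex. z ^ n = 1} \<subseteq> {z. cmod z = 1}"
  proof
    fix z :: complex assume "z \<in> {z. z ^ n = 1}"
    hence "z ^ n = 1" by simp
    from power_eq_1_iff[OF this] show "z \<in> {z. cmod z = 1}" by (simp add: n_def)
  qed
  hence "card {z :: complex. z ^ n = 1} \<le> card {z :: complex. cmod z = 1}"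
    by (rule card_mono[OF fin])
  thus False using card_roots_unity_eq[of n] by (simp add: n_def)
qed

lemma poly_eqI_on_circle:
  fixes p q :: "complex poly"
  assumes "\<And>z. cmod z = 1 \<Longrightarrow> poly p z = poly q z"
  shows "p = q"
proof -
  have "infinite {z. poly (p - q) z = 0}"
    by (rule infinite_super[OF _ infinite_unit_circle]) (use assms in auto)
  thus ?thesis using poly_roots_finite[of "p - q"] by auto
qed

lemma inverse_cnj_unit: "cmod z = 1 \<Longrightarrow> 1 / cnj z = z"
  using complex_norm_square[of z] by (auto simp: divide_eq_eq)

section \<open>Polynomial matrices with orthonormal rows on the circle\<close>

text \<open>
  Rectangular matrices are included so that a single row of unit norm and a whole paraunitary matrix
  fall under the same notion and can be factored by the same lemma.
\<close>

definition coisometric :: "complex poly mat \<Rightarrow> bool" where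
  "coisometric A \<longleftrightarrow>
     (\<forall>z. cmod z = 1 \<longrightarrow> eval_pmat A z * mat_adjoint (eval_pmat A z) = 1\<^sub>m (dim_row A))"

lemma degree_bound_exists:
  fixes A :: "complex poly mat"
  obtains K where "N \<le> K" "\<forall>i<dim_row A. \<forall>j<dim_col A. degree (A $$ (i, j)) \<le> K"
proof -
  define K where "K = N + (\<Sum>i<dim_row A. \<Sum>j<dim_col A. degree (A $$ (i, j)))"
  have "degree (A $$ (i, j)) \<le> K" if "i < dim_row A" "j < dim_col A" for i j
  proof -
    have "degree (A $$ (i, j)) \<le> (\<Sum>j<dim_col A. degree (A $$ (i, j)))"
      using that by (intro member_le_sum) auto
    also have "\<dots> \<le> (\<Sum>i<dim_row A. \<Sum>j<dim_col A. degree (A $$ (i, j)))"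
      using that member_le_sum[of i "{..<dim_row A}" "\<lambda>i. \<Sum>j<dim_col A. degree (A $$ (i, j))"] by auto
    finally show ?thesis by (simp add: K_def)
  qed
  thus thesis using that[of K] by (simp add: K_def)
qed

text \<open>
  This is \<open>A A\<^sup>* = 1\<close> multiplied by \<open>z\<^sup>K\<close>.  Both sides are polynomials agreeing at the infinitely many
  points of the circle.
\<close>

lemma coisometric_poly_identity:
  assumes A: "A \<in> carrier_mat r m" and iso: "coisometric A"
    and deg: "\<forall>i<r. \<forall>j<m. degree (A $$ (i, j)) \<le> K"
    and ij: "i < r" "j < r"
  shows "(\<Sum>k<m. A $$ (i, k) * conj_reverse K (A $$ (j, k))) = (if i = j then monom 1 K else 0)"
proof (rule poly_eqI_on_circle)
  fix z :: complex assume z: "cmod z = 1"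
  hence nz: "z \<noteq> 0" by auto
  have "(\<Sum>k<m. poly (A $$ (i, k)) z * cnj (poly (A $$ (j, k)) z))
      = (eval_pmat A z * mat_adjoint (eval_pmat A z)) $$ (i, j)"
    unfolding index_mult_adjoint[OF eval_pmat_carrier[OF A] eval_pmat_carrier[OF A] ij]
    using A ij by (simp add: eval_pmat_def)
  also have "\<dots> = (if i = j then 1 else 0)"
    using iso z A ij by (simp add: coisometric_def)
  finally have *: "(\<Sum>k<m. poly (A $$ (i, k)) z * cnj (poly (A $$ (j, k)) z)) = (if i = j then 1 else 0)" .
  have "poly (\<Sum>k<m. A $$ (i, k) * conj_reverse K (A $$ (j, k))) z
      = z ^ K * (\<Sum>k<m. poly (A $$ (i, k)) z * cnj (poly (A $$ (j, k)) z))"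
    using deg ij nz inverse_cnj_unit[OF z]
    by (simp add: poly_sum poly_conj_reverse sum_distrib_left mult_ac)
  thus "poly (\<Sum>k<m. A $$ (i, k) * conj_reverse K (A $$ (j, k))) z
      = poly (if i = j then monom 1 K else 0) z"
    unfolding * by (simp add: poly_monom)
qed

text \<open>
  The constant coefficient in the polynomial form of \<open>A A\<^sup>* = 1\<close>; with \<open>K > 0\<close> the right-hand side
  contributes nothing to it.
\<close>

lemma extreme_coeffs_orthogonal:
  assumes A: "A \<in> carrier_mat r m" and iso: "coisometric A" and "K > 0"
    and deg: "\<forall>i<r. \<forall>j<m. degree (A $$ (i, j)) \<le> K"
    and ij: "i < r" "j < r"
  shows "(\<Sum>k<m. coeff (A $$ (i, k)) 0 * cnj (coeff (A $$ (j, k)) K)) = 0"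
proof -
  have "coeff (\<Sum>k<m. A $$ (i, k) * conj_reverse K (A $$ (j, k))) 0 = 0"
    unfolding coisometric_poly_identity[OF A iso deg ij] using \<open>K > 0\<close> by (simp add: coeff_monom)
  thus ?thesis by (simp add: coeff_sum coeff_mult coeff_conj_reverse)
qed

text \<open>
  The identity on the circle extends to the punctured plane because, multiplied by \<open>z\<^sup>K\<close>, it is
  an identity between polynomials.
\<close>

lemma coisometric_imp_paraunitary:
  assumes U: "U \<in> carrier_mat m m" and iso: "coisometric U"
  shows "paraunitary m U"
  unfolding paraunitary_def
proof (intro conjI allI impI)
  fix z :: complex assume z: "z \<noteq> 0"
  obtain K where K: "\<forall>i<m. \<forall>j<m. degree (U $$ (i, j)) \<le> K"
    using degree_bound_exists[of 0 U] U by auto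
  show "eval_pmat U z * para_adjoint U z = 1\<^sub>m m"
  proof (rule eq_matI)
    fix i j assume "i < dim_row (1\<^sub>m m :: complex mat)" "j < dim_col (1\<^sub>m m :: complex mat)"
    hence ij: "i < m" "j < m" by auto
    have "z ^ K * (eval_pmat U z * para_adjoint U z) $$ (i, j)
        = poly (\<Sum>k<m. U $$ (i, k) * conj_reverse K (U $$ (j, k))) z"
      unfolding para_adjoint_def index_mult_adjoint[OF eval_pmat_carrier[OF U] eval_pmat_carrier[OF U] ij]
      using ij U K z by (simp add: eval_pmat_def poly_sum poly_conj_reverse sum_distrib_left mult_ac)
    also have "\<dots> = z ^ K * (1\<^sub>m m $$ (i, j))"
      unfolding coisometric_poly_identity[OF U iso K ij] using ij by (simp add: poly_monom)
    finally show "(eval_pmat U z * para_adjoint U z) $$ (i, j) = 1\<^sub>m m $$ (i, j)"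
      using z by simp
  qed (use U in \<open>auto simp: para_adjoint_def mat_adjoint_eq eval_pmat_def\<close>)
qed (rule U)

lemma paraunitary_imp_coisometric:
  assumes "paraunitary m U"
  shows "coisometric U"
  unfolding coisometric_def
proof (intro allI impI)
  fix z :: complex assume z: "cmod z = 1"
  hence "z \<noteq> 0" by auto
  thus "eval_pmat U z * mat_adjoint (eval_pmat U z) = 1\<^sub>m (dim_row U)"
    using assms inverse_cnj_unit[OF z] by (auto simp: paraunitary_def para_adjoint_def)
qed

text \<open>
  Multiplying \<open>U U\<^sup>* = 1\<close> by \<open>z\<^sup>K adj U\<close> gives \<open>c z\<^sup>N R = z\<^sup>K adj U\<close>, where \<open>R\<close> is the polynomial matrix
  \<open>z\<^sup>K U\<^sup>*\<close>.  So \<open>R\<close> has no powers of \<open>z\<close> with exponent below \<open>K - N\<close>, which says that \<open>U\<close> has none with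
  exponent above \<open>N\<close>.
\<close>

lemma degree_le_of_det_monom:
  assumes U: "U \<in> carrier_mat m m" and iso: "coisometric U"
    and det: "det U = monom c N" "c \<noteq> 0" and ij: "i < m" "j < m"
  shows "degree (U $$ (i, j)) \<le> N"
proof -
  obtain K where NK: "N \<le> K" and K: "\<forall>i<m. \<forall>j<m. degree (U $$ (i, j)) \<le> K"
    using degree_bound_exists[of N U] U by auto
  define R where "R = mat m m (\<lambda>(i, j). conj_reverse K (U $$ (j, i)))"
  have R: "R \<in> carrier_mat m m" by (simp add: R_def)
  note adj = adj_mat[OF U]
  have UR: "U * R = monom 1 K \<cdot>\<^sub>m 1\<^sub>m m"
  proof (rule eq_matI)
    fix i j assume "i < dim_row (monom 1 K \<cdot>\<^sub>m 1\<^sub>m m :: complex poly mat)"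
      "j < dim_col (monom 1 K \<cdot>\<^sub>m 1\<^sub>m m :: complex poly mat)"
    hence ij: "i < m" "j < m" by auto
    show "(U * R) $$ (i, j) = (monom 1 K \<cdot>\<^sub>m 1\<^sub>m m) $$ (i, j)"
      unfolding index_mult_mat_sum[OF U R ij]
      using coisometric_poly_identity[OF U iso K ij] ij by (simp add: R_def)
  qed (use U R in auto)
  have "det U \<cdot>\<^sub>m R = (adj_mat U * U) * R"
    unfolding adj(3) using R by (simp add: mult_smult_assoc_mat[OF one_carrier_mat R])
  also have "\<dots> = adj_mat U * (monom 1 K \<cdot>\<^sub>m 1\<^sub>m m)"
    using assoc_mult_mat[OF adj(1) U R] UR by simp
  also have "\<dots> = monom 1 K \<cdot>\<^sub>m adj_mat U"
    using adj(1) by (simp add: mult_smult_distrib[OF adj(1) one_carrier_mat])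
  finally have eq: "monom c N * R $$ (j, i) = monom 1 K * adj_mat U $$ (j, i)"
    using ij R adj(1) det(1) by (metis (no_types, lifting) carrier_matD index_smult_mat(1))
  have "coeff (U $$ (i, j)) n = 0" if n: "n > N" for n
  proof (cases "n \<le> K")
    case True
    have "c * coeff (R $$ (j, i)) (K - n) = coeff (monom c N * R $$ (j, i)) (N + (K - n))"
      by (simp add: coeff_monom_mult)
    also have "\<dots> = 0" unfolding eq using n True by (simp add: coeff_monom_mult)
    finally show ?thesis using True ij \<open>c \<noteq> 0\<close> by (simp add: R_def coeff_conj_reverse)
  next
    case False
    thus ?thesis using K ij by (intro coeff_eq_0) (meson le_less_trans not_le)
  qed
  thus ?thesis by (intro degree_le) auto
qed


section \<open>Products and cancellation\<close>

lemma coisometric_mult: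
  assumes A: "A \<in> carrier_mat r m" and B: "B \<in> carrier_mat m k"
    and iso: "coisometric A" "coisometric B"
  shows "coisometric (A * B)"
  unfolding coisometric_def
proof (intro allI impI)
  fix z :: complex assume z: "cmod z = 1"
  let ?A = "eval_pmat A z" and ?B = "eval_pmat B z"
  have c: "?A \<in> carrier_mat r m" "?B \<in> carrier_mat m k" using A B by auto
  have "?A * (?B * mat_adjoint ?B) * mat_adjoint ?A = 1\<^sub>m r"
    using iso z A B right_mult_one_mat[OF c(1)] by (simp add: coisometric_def)
  thus "eval_pmat (A * B) z * mat_adjoint (eval_pmat (A * B) z) = 1\<^sub>m (dim_row (A * B))"
    using A by (simp add: eval_pmat_mult[OF A B] gram_mat_mult[OF c])
qed

text \<open>
  On the circle \<open>B\<close> is a unitary matrix, so \<open>Y Y\<^sup>* = Y B B\<^sup>* Y\<^sup>*\<close>.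
\<close>

lemma coisometric_cancel_right:
  assumes Y: "Y \<in> carrier_mat r m" and B: "B \<in> carrier_mat m m"
    and iso: "coisometric (Y * B)" "coisometric B"
  shows "coisometric Y"
  unfolding coisometric_def
proof (intro allI impI)
  fix z :: complex assume z: "cmod z = 1"
  let ?Y = "eval_pmat Y z" and ?B = "eval_pmat B z"
  have c: "?Y \<in> carrier_mat r m" "?B \<in> carrier_mat m m" using Y B by auto
  have BB: "?B * mat_adjoint ?B = 1\<^sub>m m" using iso z B by (simp add: coisometric_def)
  have "?Y * mat_adjoint ?Y = ?Y * (?B * mat_adjoint ?B) * mat_adjoint ?Y"
    unfolding BB right_mult_one_mat[OF c(1)] ..
  also have "\<dots> = eval_pmat (Y * B) z * mat_adjoint (eval_pmat (Y * B) z)"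
    by (simp add: eval_pmat_mult[OF Y B] gram_mat_mult[OF c])
  also have "\<dots> = 1\<^sub>m r" using iso z Y by (simp add: coisometric_def)
  finally show "?Y * mat_adjoint ?Y = 1\<^sub>m (dim_row Y)" using Y by simp
qed

section \<open>Splitting off a factor of degree one\<close>

definition const_pmat :: "complex mat \<Rightarrow> complex poly mat" where
  "const_pmat Q = map_mat (\<lambda>c. [:c:]) Q"

definition first_shift :: "nat \<Rightarrow> complex poly mat" where
  "first_shift m = mat m m (\<lambda>(i, j). if i = j then (if i = 0 then monom 1 1 else 1) else 0)"

lemma const_pmat_carrier [simp, intro]: "Q \<in> carrier_mat n m \<Longrightarrow> const_pmat Q \<in> carrier_mat n m"
  by (auto simp: const_pmat_def)

lemma first_shift_carrier [simp, intro]: "first_shift m \<in> carrier_mat m m"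
  by (simp add: first_shift_def)

lemma dim_const_pmat [simp]:
  "dim_row (const_pmat Q) = dim_row Q" "dim_col (const_pmat Q) = dim_col Q"
  by (simp_all add: const_pmat_def)

lemma dim_first_shift [simp]: "dim_row (first_shift m) = m" "dim_col (first_shift m) = m"
  by (simp_all add: first_shift_def)

lemma eval_const_pmat [simp]: "eval_pmat (const_pmat Q) z = Q"
  by (intro eq_matI) (auto simp: eval_pmat_def const_pmat_def)

lemma coisometric_const_pmat: "unitary_mat m Q \<Longrightarrow> coisometric (const_pmat Q)"
  by (auto simp: coisometric_def unitary_mat_def)

lemma coisometric_first_shift: "coisometric (first_shift m)"
  unfolding coisometric_def
proof (intro allI impI)
  fix z :: complex assume "cmod z = 1"
  hence z: "z * cnj z = 1" using complex_norm_square[of z] by simp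
  let ?E = "eval_pmat (first_shift m) z"
  have E: "?E \<in> carrier_mat m m" by auto
  have Eij: "?E $$ (i, j) = (if i = j then (if i = 0 then z else 1) else 0)" if "i < m" "j < m" for i j
    using that by (simp add: eval_pmat_def first_shift_def poly_monom)
  have "?E * mat_adjoint ?E = 1\<^sub>m m"
  proof (rule eq_matI)
    fix i j assume "i < dim_row (1\<^sub>m m :: complex mat)" "j < dim_col (1\<^sub>m m :: complex mat)"
    hence ij: "i < m" "j < m" by auto
    have "(?E * mat_adjoint ?E) $$ (i, j)
        = (\<Sum>k<m. if k = i then (if i = j then (if i = 0 then z * cnj z else 1) else 0) else 0)"
      unfolding index_mult_adjoint[OF E E ij] using ij by (intro sum.cong) (auto simp: Eij)
    thus "(?E * mat_adjoint ?E) $$ (i, j) = 1\<^sub>m m $$ (i, j)" using ij z by simp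
  qed (use E in \<open>auto simp: mat_adjoint_eq\<close>)
  thus "?E * mat_adjoint ?E = 1\<^sub>m (dim_row (first_shift m))" by (simp add: first_shift_def)
qed

lemma det_const_pmat: "det (const_pmat Q) = [:det Q:]"
proof -
  have "comm_ring_hom (\<lambda>c :: complex. [:c:])" by unfold_locales auto
  thus ?thesis unfolding const_pmat_def by (rule comm_ring_hom.hom_det)
qed

lemma cmod_det_unitary:
  assumes "unitary_mat m Q"
  shows "cmod (det Q) = 1"
proof -
  have Q: "Q \<in> carrier_mat m m" "Q * mat_adjoint Q = 1\<^sub>m m" using assms by (auto simp: unitary_mat_def)
  have "mat_adjoint Q = transpose_mat (map_mat cnj Q)"
    by (intro eq_matI) (auto simp: mat_adjoint_eq)
  moreover have "comm_ring_hom cnj" by unfold_locales auto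
  ultimately have "det (mat_adjoint Q) = cnj (det Q)"
    using det_transpose[of "map_mat cnj Q" m] Q comm_ring_hom.hom_det[of cnj Q] by simp
  hence "det Q * cnj (det Q) = 1"
    using det_mult[OF Q(1) mat_adjoint_carrier[OF Q(1)]] Q(2) by simp
  thus ?thesis by (simp add: complex_mod_sqrt_Re_mult_cnj)
qed

lemma det_first_shift: "m > 0 \<Longrightarrow> det (first_shift m) = monom 1 1"
proof -
  assume m: "m > 0"
  have "det (first_shift m) = prod_list (diag_mat (first_shift m))"
    by (rule det_upper_triangular[of _ m]) (auto simp: first_shift_def)
  also have "\<dots> = (\<Prod>i<m. if i = 0 then monom 1 1 else 1)"
    by (simp add: prod_list_diag_prod first_shift_def lessThan_atLeast0)
  also have "\<dots> = monom 1 1" using m by simp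
  finally show ?thesis .
qed

definition elementary_factor :: "nat \<Rightarrow> complex mat \<Rightarrow> complex poly mat" where
  "elementary_factor m Q = first_shift m * const_pmat Q"

lemma elementary_factor_paraunitary:
  assumes Q: "unitary_mat m Q" and m: "m > 0"
  shows "elementary_factor m Q \<in> carrier_mat m m"
    and "coisometric (elementary_factor m Q)"
    and "det (elementary_factor m Q) = monom (det Q) 1"
proof -
  have c: "const_pmat Q \<in> carrier_mat m m" using Q by (auto simp: unitary_mat_def)
  show "elementary_factor m Q \<in> carrier_mat m m" "coisometric (elementary_factor m Q)"
    using coisometric_mult[OF first_shift_carrier c coisometric_first_shift coisometric_const_pmat[OF Q]] c
    by (auto simp: elementary_factor_def intro: mult_carrier_mat)
  show "det (elementary_factor m Q) = monom (det Q) 1"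
    using det_mult[OF first_shift_carrier c] det_first_shift[OF m]
    by (simp add: elementary_factor_def det_const_pmat monom_altdef)
qed

text \<open>
  \<open>A Q\<^sup>*\<close> with its first column divided by \<open>z\<close>.  The division drops the constant coefficients of
  that column, so the result is a factor of \<open>A\<close> only if they vanish.
\<close>

definition split_off :: "complex mat \<Rightarrow> complex poly mat \<Rightarrow> complex poly mat" where
  "split_off Q A = mat (dim_row A) (dim_col A) (\<lambda>(i, j).
     poly_shift (if j = 0 then 1 else 0) (\<Sum>k<dim_col A. smult (cnj (Q $$ (j, k))) (A $$ (i, k))))"

lemma split_off_carrier [simp, intro]: "A \<in> carrier_mat r m \<Longrightarrow> split_off Q A \<in> carrier_mat r m"
  by (simp add: split_off_def)

lemma coeff_split_off:
  assumes "A \<in> carrier_mat r m" "i < r" "j < m"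
  shows "coeff (split_off Q A $$ (i, j)) n
    = (\<Sum>k<m. coeff (A $$ (i, k)) (if j = 0 then Suc n else n) * cnj (Q $$ (j, k)))"
  using assms by (simp add: split_off_def coeff_poly_shift coeff_sum mult.commute)

text \<open>
  The hypothesis says that the first column of \<open>A Q\<^sup>*\<close> vanishes at \<open>0\<close>, so that this column is
  divisible by \<open>z\<close>.
\<close>

lemma split_off_mult:
  assumes A: "A \<in> carrier_mat r m" and Q: "unitary_mat m Q"
    and zero: "\<forall>i<r. (\<Sum>k<m. coeff (A $$ (i, k)) 0 * cnj (Q $$ (0, k))) = 0"
  shows "split_off Q A * elementary_factor m Q = A"
proof -
  have Qc: "Q \<in> carrier_mat m m" and QQ: "mat_adjoint Q * Q = 1\<^sub>m m"
    using Q by (auto simp: unitary_mat_def)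
  define X where "X = A * const_pmat (mat_adjoint Q)"
  have cc: "const_pmat (mat_adjoint Q) \<in> carrier_mat m m" "const_pmat Q \<in> carrier_mat m m"
    using Qc by auto
  have X: "X \<in> carrier_mat r m" using A cc by (auto simp: X_def)
  have coeff_X: "coeff (X $$ (i, j)) n = (\<Sum>k<m. coeff (A $$ (i, k)) n * cnj (Q $$ (j, k)))"
    if "i < r" "j < m" for i j n
    unfolding X_def index_mult_mat_sum[OF A cc(1) that] using that Qc
    by (simp add: coeff_sum const_pmat_def mat_adjoint_eq mult.commute)
  have "split_off Q A * first_shift m = X"
  proof (rule eq_matI)
    fix i j assume "i < dim_row X" "j < dim_col X"
    hence ij: "i < r" "j < m" using X by auto
    have "(split_off Q A * first_shift m) $$ (i, j)
        = (\<Sum>k<m. if k = j then (if j = 0 then monom 1 1 else 1) * split_off Q A $$ (i, j) else 0)"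
      unfolding index_mult_mat_sum[OF split_off_carrier[OF A] first_shift_carrier ij] using ij
      by (intro sum.cong) (auto simp: first_shift_def)
    also have "\<dots> = (if j = 0 then monom 1 1 else 1) * split_off Q A $$ (i, j)"
      using ij by simp
    also have "\<dots> = X $$ (i, j)"
    proof (rule poly_eqI)
      fix n
      show "coeff ((if j = 0 then monom 1 1 else 1) * split_off Q A $$ (i, j)) n = coeff (X $$ (i, j)) n"
        using zero ij
        by (cases n) (auto simp: coeff_X coeff_split_off[OF A] coeff_monom_mult)
    qed
    finally show "(split_off Q A * first_shift m) $$ (i, j) = X $$ (i, j)" .
  qed (use A X in \<open>auto simp: split_off_def first_shift_def\<close>)
  hence "split_off Q A * elementary_factor m Q = X * const_pmat Q"
    unfolding elementary_factor_def
    using assoc_mult_mat[OF split_off_carrier[OF A, where Q = Q] first_shift_carrier cc(2)] by simp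
  also have "\<dots> = A * (const_pmat (mat_adjoint Q) * const_pmat Q)"
    unfolding X_def using assoc_mult_mat[OF A cc] by simp
  also have "const_pmat (mat_adjoint Q) * const_pmat Q = const_pmat (mat_adjoint Q * Q)"
  proof -
    have "semiring_hom (\<lambda>c :: complex. [:c:])" by unfold_locales auto
    from semiring_hom.mat_hom_mult[OF this mat_adjoint_carrier[OF Qc] Qc]
    show ?thesis by (simp add: const_pmat_def)
  qed
  also have "\<dots> = 1\<^sub>m m" unfolding QQ by (intro eq_matI) (auto simp: const_pmat_def)
  finally show ?thesis using A by simp
qed

text \<open>
  The first row of the quotient depends on the first row of the matrix alone.  Hence all completions
  of \<open>u\<close> lead to quotients with the same first row, namely the quotient of \<open>u\<close> itself.
\<close>

lemma row_split_off_cong: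
  assumes "A \<in> carrier_mat r m" "A' \<in> carrier_mat r' m" "0 < r" "0 < r'" "row A 0 = row A' 0"
  shows "row (split_off Q A) 0 = row (split_off Q A') 0"
proof -
  have "A $$ (0, k) = A' $$ (0, k)" if "k < m" for k
    using arg_cong[OF assms(5), of "\<lambda>v. v $ k"] assms(1-4) that by simp
  thus ?thesis using assms by (intro eq_vecI) (auto simp: split_off_def)
qed

section \<open>Completions of a unit row\<close>

text \<open>
  The length of \<open>U\<close> is left out because the determinant and the first row determine it, and only
  the values on the circle are prescribed; \<open>paraunitary_completion_iff\<close> shows that nothing is lost.
\<close>

definition completes :: "nat \<Rightarrow> nat \<Rightarrow> complex poly vec \<Rightarrow> complex poly mat \<Rightarrow> bool" where
  "completes m N u U \<longleftrightarrow> U \<in> carrier_mat m m \<and> coisometric U \<and>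
     (\<exists>c. cmod c = 1 \<and> det U = monom c N) \<and> row U 0 = u"

definition unit_row :: "nat \<Rightarrow> nat \<Rightarrow> complex poly vec \<Rightarrow> bool" where
  "unit_row m N u \<longleftrightarrow> u \<in> carrier_vec m \<and> coisometric (mat_of_row u) \<and>
     (\<forall>j<m. degree (u $ j) \<le> N) \<and> (\<exists>j<m. coeff (u $ j) N \<noteq> 0)"

text \<open>
  The determinant bounds the degree of \<open>U\<close> by \<open>N\<close>, and the first row has a non-zero coefficient at
  \<open>z\<^sup>N\<close>, so \<open>U\<close> has length \<open>N\<close>.
\<close>

lemma paraunitary_completion_iff:
  assumes m: "m > 0" and u: "unit_row m N u"
  shows "paraunitary_completion m N u U \<longleftrightarrow> completes m N u U"
proof
  assume "paraunitary_completion m N u U"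
  then obtain c where c: "cmod c = 1" "\<And>z. det (eval_pmat U z) = c * z ^ N"
    and U: "paraunitary m U" "row U 0 = u"
    by (auto simp: paraunitary_completion_def)
  have "det U = monom c N"
    by (rule poly_eqI_on_circle) (use c(2) in \<open>simp add: det_eval_pmat poly_monom\<close>)
  thus "completes m N u U" 
    using c(1) U paraunitary_imp_coisometric[OF U(1)] by (auto simp: completes_def paraunitary_def)
next
  assume U: "completes m N u U"
  then obtain c where c: "cmod c = 1" "det U = monom c N" and iso: "coisometric U"
    and Um: "U \<in> carrier_mat m m" and row: "row U 0 = u"
    by (auto simp: completes_def)
  from c have c0: "c \<noteq> 0" by auto
  obtain j where j: "j < m" "coeff (u $ j) N \<noteq> 0" using u by (auto simp: unit_row_def)
  hence "coeff_pmat U N $$ (0, j) \<noteq> 0"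
    using row Um m by (auto simp: coeff_pmat_def)
  hence "coeff_pmat U N \<noteq> 0\<^sub>m m m" using j m by auto
  moreover have "coeff_pmat U n = 0\<^sub>m m m" if "n > N" for n
  proof (rule eq_matI)
    fix i j assume "i < dim_row (0\<^sub>m m m :: complex mat)" "j < dim_col (0\<^sub>m m m :: complex mat)"
    hence ij: "i < m" "j < m" by auto
    have "coeff (U $$ (i, j)) n = 0"
      using le_less_trans[OF degree_le_of_det_monom[OF Um iso c(2) c0 ij] that] by (rule coeff_eq_0)
    thus "coeff_pmat U n $$ (i, j) = 0\<^sub>m m m $$ (i, j)" using ij Um by (simp add: coeff_pmat_def)
  qed (use Um in \<open>auto simp: coeff_pmat_def\<close>)
  ultimately have "pmat_length U N" using Um by (auto simp: pmat_length_def)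
  thus "paraunitary_completion m N u U"
    using coisometric_imp_paraunitary[OF Um iso] c row
    by (auto simp: paraunitary_completion_def det_eval_pmat poly_monom)
qed

section \<open>Length zero: constant completions\<close>

lemma unitary_fixing_first_row:
  assumes W: "unitary_mat m W" and m: "m > 0"
    and row: "\<And>j. j < m \<Longrightarrow> W $$ (0, j) = (if j = 0 then 1 else 0)"
    and col: "\<And>i. i < m \<Longrightarrow> W $$ (i, 0) = (if i = 0 then 1 else 0)"
  obtains V where "unitary_mat (m - 1) V"
    "W = four_block_mat (1\<^sub>m 1) (0\<^sub>m 1 (m - 1)) (0\<^sub>m (m - 1) 1) V"
proof -
  obtain k where k: "m = Suc k" using m by (cases m) auto
  have Wm: "W \<in> carrier_mat m m" and WW: "W * mat_adjoint W = 1\<^sub>m m"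
    using W by (auto simp: unitary_mat_def)
  define V where "V = mat k k (\<lambda>(i, j). W $$ (Suc i, Suc j))"
  have V: "V \<in> carrier_mat k k" by (simp add: V_def)
  have "unitary_mat k V"
  proof (rule unitary_matI[OF V], rule eq_matI)
    fix i j assume "i < dim_row (1\<^sub>m k :: complex mat)" "j < dim_col (1\<^sub>m k :: complex mat)"
    hence ij: "i < k" "j < k" by auto
    have "(W * mat_adjoint W) $$ (Suc i, Suc j)
        = (\<Sum>l<Suc k. W $$ (Suc i, l) * cnj (W $$ (Suc j, l)))"
      using index_mult_adjoint[OF Wm Wm, of "Suc i" "Suc j"] ij k by simp
    also have "\<dots> = (\<Sum>l<k. W $$ (Suc i, Suc l) * cnj (W $$ (Suc j, Suc l)))"
      unfolding sum.lessThan_Suc_shift using col[of "Suc i"] ij k by simp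
    also have "\<dots> = (V * mat_adjoint V) $$ (i, j)"
      unfolding index_mult_adjoint[OF V V ij] using ij by (simp add: V_def)
    finally show "(V * mat_adjoint V) $$ (i, j) = 1\<^sub>m k $$ (i, j)"
      unfolding WW using ij k by simp
  qed (use V in \<open>auto simp: mat_adjoint_eq\<close>)
  moreover have "W = four_block_mat (1\<^sub>m 1) (0\<^sub>m 1 (m - 1)) (0\<^sub>m (m - 1) 1) V"
    using Wm V k row col by (intro eq_matI) (auto simp: four_block_mat_def V_def Let_def)
  ultimately show thesis using that k by simp
qed

text \<open>
  The entries of \<open>u\<close> are constants and \<open>u\<close> has norm one, so the scaling factor in
  \<open>unitary_with_first_row\<close> is one.
\<close>

lemma constant_unit_row_completion:
  assumes m: "m > 0" and u: "unit_row m 0 u"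
  shows "\<exists>U. completes m 0 u U"
proof -
  have um: "u \<in> carrier_vec m" and u_iso: "coisometric (mat_of_row u)"
    and u_deg: "\<forall>j<m. degree (u $ j) \<le> 0" and u_nz: "\<exists>j<m. coeff (u $ j) 0 \<noteq> 0"
    using u by (auto simp: unit_row_def)
  define a where "a = vec m (\<lambda>j. coeff (u $ j) 0)"
  have ua: "u $ j = [:a $ j:]" if "j < m" for j
    using u_deg that by (auto simp: a_def elim!: degree_eq_zeroE)
  have "a \<in> carrier_vec m" "a \<noteq> 0\<^sub>v m" using u_nz by (auto simp: a_def vec_eq_iff)
  then obtain Q where Q: "unitary_mat m Q"
    and aQ: "\<And>j. j < m \<Longrightarrow> a $ j = of_real (sqrt (\<Sum>k<m. (cmod (a $ k))\<^sup>2)) * Q $$ (0, j)"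
    by (rule unitary_with_first_row) blast
  have Qm: "Q \<in> carrier_mat m m" using Q by (auto simp: unitary_mat_def)
  have "(\<Sum>k<m. a $ k * cnj (a $ k)) = 1"
  proof -
    let ?u = "eval_pmat (mat_of_row u) 1"
    have less_1: "(0 :: nat) < 1" by simp
    have c: "?u \<in> carrier_mat 1 m" using um by auto
    have "(?u * mat_adjoint ?u) $$ (0, 0) = 1" using u_iso by (simp add: coisometric_def)
    thus ?thesis unfolding index_mult_adjoint[OF c c less_1 less_1]
      using um by (simp add: eval_pmat_def ua)
  qed
  hence "complex_of_real (\<Sum>k<m. (cmod (a $ k))\<^sup>2) = 1"
    by (simp add: complex_norm_square del: of_real_power)
  hence "(\<Sum>k<m. (cmod (a $ k))\<^sup>2) = 1" by (simp only: of_real_eq_1_iff)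
  hence norm_a: "complex_of_real (sqrt (\<Sum>k<m. (cmod (a $ k))\<^sup>2)) = 1" by simp
  have "a $ j = Q $$ (0, j)" if "j < m" for j
    using aQ[OF that] unfolding norm_a by simp
  hence "row (const_pmat Q) 0 = u"
    using ua um Qm m by (intro eq_vecI) (auto simp: const_pmat_def)
  thus ?thesis
    using Qm cmod_det_unitary[OF Q] coisometric_const_pmat[OF Q]
    by (intro exI[of _ "const_pmat Q"]) (auto simp: completes_def det_const_pmat monom_0)
qed

text \<open>
  By the degree bound the two completions are constant unitary matrices \<open>G\<close> and \<open>H\<close> with the same first
  row, and \<open>H G\<^sup>*\<close> inherits its first row from \<open>G G\<^sup>* = 1\<close> and its first column from \<open>H H\<^sup>* = 1\<close>.
\<close>

lemma constant_completions_differ_by_block: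
  assumes m: "m > 0" and U: "completes m 0 u U" and U': "completes m 0 u U'"
  shows "\<exists>V. unitary_mat (m - 1) V \<and> (\<forall>z. eval_pmat U' z =
     four_block_mat (1\<^sub>m 1) (0\<^sub>m 1 (m - 1)) (0\<^sub>m (m - 1) 1) V * eval_pmat U z)"
proof -
  have const: "\<exists>G. unitary_mat m G \<and> (\<forall>z. eval_pmat X z = G) \<and> (\<forall>j<m. u $ j = [:G $$ (0, j):])"
    if X: "completes m 0 u X" for X
  proof -
    obtain c where c: "cmod c = 1" "det X = monom c 0" and Xm: "X \<in> carrier_mat m m"
      and iso: "coisometric X" and row: "row X 0 = u" using X by (auto simp: completes_def)
    have "c \<noteq> 0" using c by auto
    hence deg: "degree (X $$ (i, j)) = 0" if "i < m" "j < m" for i j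
      using degree_le_of_det_monom[OF Xm iso c(2) _ that] by simp
    define G where "G = map_mat (\<lambda>p. coeff p 0) X"
    have XG: "X $$ (i, j) = [:G $$ (i, j):]" if "i < m" "j < m" for i j
      using deg[OF that] that Xm by (auto simp: G_def elim: degree_eq_zeroE)
    have ev: "eval_pmat X z = G" for z
    proof (rule eq_matI)
      fix i j assume "i < dim_row G" "j < dim_col G"
      hence ij: "i < m" "j < m" using Xm by (auto simp: G_def)
      thus "eval_pmat X z $$ (i, j) = G $$ (i, j)" using XG[OF ij] Xm by (simp add: eval_pmat_def)
    qed (use Xm in \<open>auto simp: G_def\<close>)
    have "G * mat_adjoint G = 1\<^sub>m m"
      using iso Xm ev unfolding coisometric_def by (metis carrier_matD(1) norm_one)
    moreover have "G \<in> carrier_mat m m" using Xm by (simp add: G_def)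
    ultimately have "unitary_mat m G" by (rule unitary_matI[rotated])
    moreover have "u $ j = [:G $$ (0, j):]" if "j < m" for j
      using XG[OF m that] Xm m that unfolding row[symmetric] by simp
    ultimately show ?thesis using ev by blast
  qed
  obtain G where G: "unitary_mat m G" "\<And>z. eval_pmat U z = G" "\<And>j. j < m \<Longrightarrow> u $ j = [:G $$ (0, j):]"
    using const[OF U] by blast
  obtain H where H: "unitary_mat m H" "\<And>z. eval_pmat U' z = H" "\<And>j. j < m \<Longrightarrow> u $ j = [:H $$ (0, j):]"
    using const[OF U'] by blast
  have GH0: "G $$ (0, j) = H $$ (0, j)" if "j < m" for j
    using G(3)[OF that] H(3)[OF that] by simp
  have Gm: "G \<in> carrier_mat m m" "G * mat_adjoint G = 1\<^sub>m m" "mat_adjoint G * G = 1\<^sub>m m"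
    and Hm: "H \<in> carrier_mat m m" "H * mat_adjoint H = 1\<^sub>m m"
    using G(1) H(1) by (auto simp: unitary_mat_def)
  define W where "W = H * mat_adjoint G"
  have Wm: "W \<in> carrier_mat m m" using Gm Hm by (auto simp: W_def)
  have "W * mat_adjoint W = 1\<^sub>m m"
    unfolding W_def using gram_mat_mult[OF Hm(1) mat_adjoint_carrier[OF Gm(1)]] Gm Hm by simp
  hence W: "unitary_mat m W" by (rule unitary_matI[OF Wm])
  have WG: "W * G = H"
    unfolding W_def using assoc_mult_mat[OF Hm(1) mat_adjoint_carrier[OF Gm(1)] Gm(1)] Gm Hm by simp
  have row: "W $$ (0, j) = (if j = 0 then 1 else 0)" if j: "j < m" for j
  proof -
    have "W $$ (0, j) = (G * mat_adjoint G) $$ (0, j)"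
      unfolding W_def index_mult_adjoint[OF Hm(1) Gm(1) m j] index_mult_adjoint[OF Gm(1) Gm(1) m j]
      using GH0 by simp
    thus ?thesis using Gm m j by simp
  qed
  have col: "W $$ (i, 0) = (if i = 0 then 1 else 0)" if i: "i < m" for i
  proof -
    have "W $$ (i, 0) = (H * mat_adjoint H) $$ (i, 0)"
      unfolding W_def index_mult_adjoint[OF Hm(1) Gm(1) i m] index_mult_adjoint[OF Hm(1) Hm(1) i m]
      using GH0 by simp
    thus ?thesis using Hm m i by simp
  qed
  obtain V where "unitary_mat (m - 1) V"
    "W = four_block_mat (1\<^sub>m 1) (0\<^sub>m 1 (m - 1)) (0\<^sub>m (m - 1) 1) V"
    using unitary_fixing_first_row[OF W m row col] by blast
  thus ?thesis using WG G(2) H(2) by auto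
qed

section \<open>Reduction of the length by one\<close>

text \<open>
  Since \<open>u = v B\<close> and \<open>B\<close> is invertible on the circle, right multiplication by \<open>B\<close> matches the
  completions of \<open>v\<close> with those of \<open>u\<close>.  That every completion of \<open>u\<close> has the factor \<open>B\<close> is what
  carries uniqueness through the induction.
\<close>

lemma unit_row_step:
  assumes m: "m > 0" and u: "unit_row m (Suc N) u"
  obtains B v where "B \<in> carrier_mat m m" "unit_row m N v"
    "\<And>Y. completes m N v Y \<Longrightarrow> completes m (Suc N) u (Y * B)"
    "\<And>U. completes m (Suc N) u U \<Longrightarrow> \<exists>Y. completes m N v Y \<and> U = Y * B"
proof -
  have um: "u \<in> carrier_vec m" and u_iso: "coisometric (mat_of_row u)"
    and u_deg: "\<forall>j<m. degree (u $ j) \<le> Suc N" and u_lead: "\<exists>j<m. coeff (u $ j) (Suc N) \<noteq> 0"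
    using u by (auto simp: unit_row_def)
  define a where "a = vec m (\<lambda>j. coeff (u $ j) (Suc N))"
  have "a \<in> carrier_vec m" "a \<noteq> 0\<^sub>v m" using u_lead by (auto simp: a_def vec_eq_iff)
  then obtain Q where Q: "unitary_mat m Q"
    and aQ: "\<And>j. j < m \<Longrightarrow> a $ j = of_real (sqrt (\<Sum>k<m. (cmod (a $ k))\<^sup>2)) * Q $$ (0, j)"
    by (rule unitary_with_first_row) blast
  define s :: complex where "s = of_real (sqrt (\<Sum>k<m. (cmod (a $ k))\<^sup>2))"
  have lead: "coeff (u $ j) (Suc N) = s * Q $$ (0, j)" if "j < m" for j
    using aQ[OF that] that by (simp add: s_def a_def)
  have s_nz: "s \<noteq> 0" using u_lead lead by auto
  have Qm: "Q \<in> carrier_mat m m" and QQ: "Q * mat_adjoint Q = 1\<^sub>m m"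
    using Q by (auto simp: unitary_mat_def)
  define B where "B = elementary_factor m Q"
  note B = elementary_factor_paraunitary[OF Q m, folded B_def]
  define d where "d = det Q"
  have d: "cmod d = 1" "d \<noteq> 0" using cmod_det_unitary[OF Q] by (auto simp: d_def)
  \<comment> \<open>Stated for \<open>r\<close> rows: it is used for the row \<open>u\<close> alone and for a whole completion of \<open>u\<close>.\<close>
  have split: "split_off Q A * B = A"
    if A: "A \<in> carrier_mat r m" and "r > 0" and iso: "coisometric A" and row: "row A 0 = u"
      and deg: "\<forall>i<r. \<forall>j<m. degree (A $$ (i, j)) \<le> Suc N" for A r
    unfolding B_def
  proof (rule split_off_mult[OF A Q], intro allI impI)
    fix i assume i: "i < r"
    have A0: "A $$ (0, k) = u $ k" if "k < m" for k
      using arg_cong[OF row, of "\<lambda>v. v $ k"] that A \<open>r > 0\<close> by simp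
    have "cnj s * (\<Sum>k<m. coeff (A $$ (i, k)) 0 * cnj (Q $$ (0, k)))
        = (\<Sum>k<m. coeff (A $$ (i, k)) 0 * cnj (coeff (A $$ (0, k)) (Suc N)))"
      unfolding sum_distrib_left by (intro sum.cong) (auto simp: A0 lead)
    also have "\<dots> = 0"
      by (rule extreme_coeffs_orthogonal[OF A iso _ deg i \<open>r > 0\<close>]) simp
    finally show "(\<Sum>k<m. coeff (A $$ (i, k)) 0 * cnj (Q $$ (0, k))) = 0" using s_nz by simp
  qed
  define A where "A = mat_of_row u"
  have A: "A \<in> carrier_mat 1 m" "row A 0 = u" using um by (auto simp: A_def)
  have AB: "split_off Q A * B = A"
    by (rule split[OF A(1)]) (use A(2) u_iso u_deg um in \<open>auto simp: A_def mat_of_row_def\<close>)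
  define v where "v = row (split_off Q A) 0"
  have vm: "v \<in> carrier_vec m" using A by (simp add: v_def split_off_def)
  have coeff_v: "coeff (v $ j) n
      = (\<Sum>k<m. coeff (u $ k) (if j = 0 then Suc n else n) * cnj (Q $$ (j, k)))" if "j < m" for j n
    using coeff_split_off[OF A(1), of 0 j Q n] that A um by (simp add: v_def A_def mat_of_row_def split_off_def)
  \<comment> \<open>The leading vector of \<open>u\<close> is a multiple of the first row of \<open>Q\<close>, so it is orthogonal to the others.\<close>
  have lead_v: "(\<Sum>k<m. coeff (u $ k) (Suc N) * cnj (Q $$ (j, k))) = (if j = 0 then s else 0)"
    if j: "j < m" for j
  proof -
    have "(\<Sum>k<m. coeff (u $ k) (Suc N) * cnj (Q $$ (j, k))) = s * (Q * mat_adjoint Q) $$ (0, j)"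
      unfolding index_mult_adjoint[OF Qm Qm m j] sum_distrib_left by (intro sum.cong) (auto simp: lead)
    thus ?thesis unfolding QQ using m j by simp
  qed
  have "unit_row m N v"
    unfolding unit_row_def
  proof (intro conjI allI impI)
    have "mat_of_row v = split_off Q A"
      using A by (intro eq_matI) (auto simp: v_def mat_of_row_def split_off_def)
    thus "coisometric (mat_of_row v)"
      using coisometric_cancel_right[OF split_off_carrier[OF A(1)] B(1) _ B(2)] AB u_iso
      by (simp add: A_def)
    fix j assume j: "j < m"
    show "degree (v $ j) \<le> N"
    proof (rule degree_le, intro allI impI)
      fix n assume n: "N < n"
      show "coeff (v $ j) n = 0"
      proof (cases "j \<noteq> 0 \<and> n = Suc N")
        \<comment> \<open>Only here is a coefficient of \<open>u\<close> involved that need not vanish for reasons of degree.\<close>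
        case True
        thus ?thesis using lead_v[OF j] by (simp add: coeff_v[OF j])
      next
        case False
        have "coeff (u $ k) (if j = 0 then Suc n else n) = 0" if "k < m" for k
          using u_deg that n False by (intro coeff_eq_0) (auto intro: le_less_trans)
        thus ?thesis by (simp add: coeff_v[OF j])
      qed
    qed
  next
    show "\<exists>j<m. coeff (v $ j) N \<noteq> 0"
      using m lead_v[OF m] s_nz by (intro exI[of _ 0]) (simp add: coeff_v)
  qed (rule vm)
  moreover have "completes m (Suc N) u (Y * B)" if Y: "completes m N v Y" for Y
  proof -
    obtain c where c: "cmod c = 1" "det Y = monom c N" and Ym: "Y \<in> carrier_mat m m"
      and iso: "coisometric Y" and row: "row Y 0 = v" using Y by (auto simp: completes_def)
    have "row (Y * B) 0 = row (split_off Q A * B) 0"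
      using row_mult[OF Ym B(1) m] row_mult[OF split_off_carrier[OF A(1)] B(1), of 0] row
      by (simp add: v_def)
    hence "row (Y * B) 0 = u" using AB A by simp
    moreover have "det (Y * B) = monom (c * d) (Suc N)"
      using det_mult[OF Ym B(1)] c B(3) by (simp add: mult_monom d_def)
    ultimately show ?thesis
      using coisometric_mult[OF Ym B(1) iso B(2)] Ym B(1) c d
      by (auto simp: completes_def norm_mult intro!: exI[of _ "c * d"])
  qed
  moreover have "\<exists>Y. completes m N v Y \<and> U = Y * B" if U: "completes m (Suc N) u U" for U
  proof (intro exI conjI)
    obtain c where c: "cmod c = 1" "det U = monom c (Suc N)" and Um: "U \<in> carrier_mat m m"
      and iso: "coisometric U" and row: "row U 0 = u" using U by (auto simp: completes_def)
    have c0: "c \<noteq> 0" using c by auto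
    have UB: "split_off Q U * B = U"
      using split[OF Um m iso row] degree_le_of_det_monom[OF Um iso c(2) c0] by blast
    thus "U = split_off Q U * B" ..
    have "det (split_off Q U) * monom d 1 = monom (c / d) N * monom d 1"
      using det_mult[OF split_off_carrier[OF Um, where Q = Q] B(1)] UB c B(3) d by (simp add: mult_monom d_def)
    hence "det (split_off Q U) = monom (c / d) N" using d by (simp add: monom_eq_0_iff)
    moreover have "coisometric (split_off Q U)"
      using coisometric_cancel_right[OF split_off_carrier[OF Um] B(1) _ B(2)] UB iso by simp
    moreover have "row (split_off Q U) 0 = v"
      unfolding v_def using row A(2) by (intro row_split_off_cong[OF Um A(1) m]) simp_all
    ultimately show "completes m N v (split_off Q U)"
      using Um c d by (auto simp: completes_def norm_divide intro!: exI[of _ "c / d"])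
  qed
  ultimately show thesis using that B(1) by blast
qed

section \<open>Existence and uniqueness\<close>

lemma completion_exists_unique:
  assumes m: "m > 0" and u: "unit_row m N u"
  shows "(\<exists>U. completes m N u U) \<and>
    (\<forall>U U'. completes m N u U \<longrightarrow> completes m N u U' \<longrightarrow>
      (\<exists>V. unitary_mat (m - 1) V \<and> (\<forall>z. eval_pmat U' z =
        four_block_mat (1\<^sub>m 1) (0\<^sub>m 1 (m - 1)) (0\<^sub>m (m - 1) 1) V * eval_pmat U z)))"
  using u
proof (induction N arbitrary: u)
  case 0
  thus ?case
    using constant_unit_row_completion[OF m] constant_completions_differ_by_block[OF m] by blast
next
  case (Suc N)
  obtain B v where B: "B \<in> carrier_mat m m" and v: "unit_row m N v"
    and mult: "\<And>Y. completes m N v Y \<Longrightarrow> completes m (Suc N) u (Y * B)"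
    and split: "\<And>U. completes m (Suc N) u U \<Longrightarrow> \<exists>Y. completes m N v Y \<and> U = Y * B"
    using unit_row_step[OF m Suc.prems] by blast
  note IH = Suc.IH[OF v]
  show ?case
  proof (intro conjI allI impI)
    show "\<exists>U. completes m (Suc N) u U" using IH mult by blast
  next
    fix U U' assume "completes m (Suc N) u U" "completes m (Suc N) u U'"
    then obtain Y Y' where Y: "completes m N v Y" "U = Y * B" and Y': "completes m N v Y'" "U' = Y' * B"
      using split by metis
    have Ym: "Y \<in> carrier_mat m m" "Y' \<in> carrier_mat m m" using Y Y' by (auto simp: completes_def)
    obtain V where V: "unitary_mat (m - 1) V" and YV: "\<And>z. eval_pmat Y' z =
        four_block_mat (1\<^sub>m 1) (0\<^sub>m 1 (m - 1)) (0\<^sub>m (m - 1) 1) V * eval_pmat Y z"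
      using IH Y(1) Y'(1) by blast
    let ?W = "four_block_mat (1\<^sub>m 1) (0\<^sub>m 1 (m - 1)) (0\<^sub>m (m - 1) 1) V"
    have W: "?W \<in> carrier_mat m m"
      using V m four_block_carrier_mat[of "1\<^sub>m 1" 1 1 V "m - 1" "m - 1"] by (simp add: unitary_mat_def)
    have "eval_pmat U' z = ?W * eval_pmat U z" for z
      unfolding Y(2) Y'(2) eval_pmat_mult[OF Ym(1) B] eval_pmat_mult[OF Ym(2) B] YV
      by (rule assoc_mult_mat[OF W eval_pmat_carrier[OF Ym(1)] eval_pmat_carrier[OF B]])
    thus "\<exists>V. unitary_mat (m - 1) V \<and> (\<forall>z. eval_pmat U' z =
        four_block_mat (1\<^sub>m 1) (0\<^sub>m 1 (m - 1)) (0\<^sub>m (m - 1) 1) V * eval_pmat U z)"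
      using V by blast
  qed
qed

theorem theorem2:
  fixes m N :: nat and U\<^sub>1 :: "complex poly vec"
  assumes "m > 0" and "N > 0"
    and "U\<^sub>1 \<in> carrier_vec m"
    and "\<forall>j<m. degree (U\<^sub>1 $ j) \<le> N"
    and "(\<Sum>j<m. cmod (coeff (U\<^sub>1 $ j) N)) > 0"
    and "\<forall>z. cmod z = 1 \<longrightarrow> (\<Sum>j<m. (cmod (poly (U\<^sub>1 $ j) z))\<^sup>2) = 1"
  shows "(\<exists>U. paraunitary_completion m N U\<^sub>1 U) \<and>
    (\<forall>U U'. paraunitary_completion m N U\<^sub>1 U \<longrightarrow> paraunitary_completion m N U\<^sub>1 U' \<longrightarrow>
      (\<exists>V. unitary_mat (m - 1) V \<and>
        (\<forall>z. eval_pmat U' z =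
          four_block_mat (1\<^sub>m 1) (0\<^sub>m 1 (m - 1)) (0\<^sub>m (m - 1) 1) V * eval_pmat U z)))"
proof -
  have "coisometric (mat_of_row U\<^sub>1)"
    unfolding coisometric_def
  proof (intro allI impI)
    fix z :: complex assume z: "cmod z = 1"
    let ?u = "eval_pmat (mat_of_row U\<^sub>1) z"
    have less_1: "(0 :: nat) < 1" by simp
    have c: "?u \<in> carrier_mat 1 m" using assms(3) by auto
    have "(?u * mat_adjoint ?u) $$ (0, 0) = of_real (\<Sum>j<m. (cmod (poly (U\<^sub>1 $ j) z))\<^sup>2)"
      unfolding index_mult_adjoint[OF c c less_1 less_1] of_real_sum
      using assms(3) by (intro sum.cong) (auto simp: eval_pmat_def complex_norm_square simp del: of_real_power)
    also have "\<dots> = 1" using assms(6) z by simp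
    finally show "?u * mat_adjoint ?u = 1\<^sub>m (dim_row (mat_of_row U\<^sub>1))"
      by (intro eq_matI) (auto simp: mat_adjoint_eq)
  qed
  moreover have "\<exists>j<m. coeff (U\<^sub>1 $ j) N \<noteq> 0"
  proof (rule ccontr)
    assume "\<not> (\<exists>j<m. coeff (U\<^sub>1 $ j) N \<noteq> 0)"
    hence "(\<Sum>j<m. cmod (coeff (U\<^sub>1 $ j) N)) = 0" by simp
    thus False using assms(5) by simp
  qed
  ultimately have u: "unit_row m N U\<^sub>1" using assms(3,4) by (simp add: unit_row_def)
  show ?thesis
    unfolding paraunitary_completion_iff[OF assms(1) u]
    by (rule completion_exists_unique[OF assms(1) u])
qed

end
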